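(* Consider a linear quantum system with $n$ oscillators, $m$ input channels, scattering matrix $S=I$, coupling operator $\mathbf{L}=[\mathbf{L}_1,\dots,\mathbf{L}_m]^\top=C_-\mathbf{a}+C_+\mathbf{a}^\#$ and Hamiltonian $\mathbf{H}$ (all notation as in the context). If $\mathbf{L}$ is a set of mutually commuting observables (i.e. $\mathbf{L}_j=\mathbf{L}_j^*$ and $[\mathbf{L}_j,\mathbf{L}_k]=0$ for all $j,k$) and $[\mathbf{L},\mathbf{H}]=0$, then QND and BAE are realized simultaneously: the components of $\mathbf{L}$ are QND variables, and the transfer matrix $\mathbb{G}[s]$ is the identity matrix, so that quantum BAE measurements are realized.
   Context: $\imath=\sqrt{-1}$; $X^\#$ is the entrywise complex conjugate (adjoint, for operator entries), $X^\dagger=(X^\#)^\top$; $\Delta(U,V)=\begin{bmatrix} U & V \\ V^\# & U^\# \end{bmatrix}$; $J_k=\mathrm{diag}(I_k,-I_k)$; for $X\in\mathbf{C}^{2k\times 2r}$, $X^\flat=J_rX^\dagger J_k$; $V_k=\frac1{\sqrt2}\begin{bmatrix} I_k & I_k \\ -\imath I_k & \imath I_k \end{bmatrix}$. A linear quantum system is specified by: a unitary $S\in\mathbf{C}^{m\times m}$; matrices $C_-,C_+\in\mathbf{C}^{m\times n}$, with $\mathcal{C}=\Delta(C_-,C_+)$; and $\Omega_-,\Omega_+\in\mathbf{C}^{n\times n}$ such that $\Omega=\Delta(\Omega_-,\Omega_+)$ is Hermitian. The coupling operator is $\mathbf{L}=C_-\mathbf{a}+C_+\mathbf{a}^\#$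 and the Hamiltonian is $\mathbf{H}=\frac12\begin{bmatrix} \mathbf{a} \\ \mathbf{a}^\# \end{bmatrix}^\dagger\Omega\begin{bmatrix} \mathbf{a} \\ \mathbf{a}^\# \end{bmatrix}$, where $\mathbf{a}=(\mathbf{a}_1,\dots,\mathbf{a}_n)^\top$ are annihilation operators with $[\mathbf{a}_j,\mathbf{a}_k^*]=\delta_{jk}$, $[\mathbf{a}_j,\mathbf{a}_k]=0$. $[\mathbf{L},\mathbf{H}]=0$ means that every component of $\mathbf{L}$ commutes with $\mathbf{H}$ (computed with these commutation relations). With $\begin{bmatrix} \mathbf{q} \\ \mathbf{p} \end{bmatrix}=V_n\begin{bmatrix} \mathbf{a} \\ \mathbf{a}^\# \end{bmatrix}$ (and similarly for inputs and outputs), in real quadrature form the system is $$\dot{\mathbf{x}}=\mathbb{A}\mathbf{x}+\mathbb{B}\mathbf{u},\qquad \mathbf{y}=\mathbb{C}\mathbf{x}+\mathbb{D}\mathbf{u},\qquad \mathbf{x}=\begin{bmatrix} \mathbf{q} \\ \mathbf{p} \end{bmatrix},\ \mathbf{u}=\begin{bmatrix} \mathbf{q}_{\rm in} \\ \mathbf{p}_{\rm in} \end{bmatrix},\ \mathbf{y}=\begin{bmatrix} \mathbf{q}_{\rm out} \\ \mathbf{p}_{\rm out} \end{bmatrix},$$ where $\mathbb{D}=V_m\Delta(S,0)V_m^\dagger$, $\mathbb{C}=V_m\mathcal{C}V_n^\dagger$, $\mathbb{B}=-V_n\mathcal{C}^\flat\Delta(S,0)V_m^\dagger$, $\mathbb{A}=V_n\left(-\imath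 J_n\Omega-\frac12\mathcal{C}^\flat\mathcal{C}\right)V_n^\dagger$ are real matrices. The transfer matrix is $\mathbb{G}[s]=\mathbb{D}+\mathbb{C}(sI-\mathbb{A})^{-1}\mathbb{B}$, partitioned into four $m\times m$ blocks conformably with $\mathbf{u}$ and $\mathbf{y}$. A BAE measurement of $\mathbf{q}_{\rm out}$ with respect to $\mathbf{p}_{\rm in}$ (resp. $\mathbf{p}_{\rm out}$ with respect to $\mathbf{q}_{\rm in}$) is realized when the corresponding off-diagonal transfer block vanishes identically. A vector of system variables $\mathbf{z}=T\mathbf{x}$ ($T$ a real matrix) is a QND variable if it evolves autonomously and independently of the inputs ($T\mathbb{A}=FT$ for some matrix $F$, and $T\mathbb{B}=0$; in particular it is uncontrollable) and is observable from the output (the rows of $T$ lie in the row space of the observability matrix of $(\mathbb{A},\mathbb{C})$). A self-adjoint $\mathbf{L}$ has the form $\mathbf{L}=T\mathbf{x}$ with $T$ real. *)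

theory Defs
  imports "HOL-Analysis.Analysis"
begin

section \<open>Complex block matrices\<close>

text \<open>Vectors of length \<open>2k\<close> are indexed by the sum type \<open>'k + 'k\<close>: \<open>Inl\<close> is the upper half
  and \<open>Inr\<close> the lower half.\<close>

definition block_matrix ::
  "'a^'n^'m \<Rightarrow> 'a^'p^'m \<Rightarrow> 'a^'n^'q \<Rightarrow> 'a^'p^'q \<Rightarrow> 'a^('n + 'p)^('m + 'q)" where
  "block_matrix A B C D = (\<chi> i j. case i of
      Inl i' \<Rightarrow> (case j of Inl j' \<Rightarrow> A $ i' $ j' | Inr j' \<Rightarrow> B $ i' $ j')
    | Inr i' \<Rightarrow> (case j of Inl j' \<Rightarrow> C $ i' $ j' | Inr j' \<Rightarrow> D $ i' $ j'))"

definition conj_matrix :: "complex^'n^'m \<Rightarrow> complex^'n^'m" where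
  "conj_matrix X = map_matrix cnj X"

definition dagger :: "complex^'n^'m \<Rightarrow> complex^'m^'n" where
  "dagger X = transpose (conj_matrix X)"

definition unitary :: "complex^'n^'n \<Rightarrow> bool" where
  "unitary U \<longleftrightarrow> dagger U ** U = mat 1 \<and> U ** dagger U = mat 1"

definition hermitian :: "complex^'n^'n \<Rightarrow> bool" where
  "hermitian X \<longleftrightarrow> dagger X = X"

definition doubled :: "complex^'n^'m \<Rightarrow> complex^'n^'m \<Rightarrow> complex^('n + 'n)^('m + 'm)" where
  "doubled U V = block_matrix U V (conj_matrix V) (conj_matrix U)"

definition Jmat :: "complex^('k::finite + 'k)^('k + 'k)" where
  "Jmat = block_matrix (mat 1) 0 0 (mat (-1))"

definition flat :: "complex^('r::finite + 'r)^('k::finite + 'k) \<Rightarrow> complex^('k + 'k)^('r + 'r)" where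
  "flat X = Jmat ** dagger X ** Jmat"

definition Vmat :: "complex^('k::finite + 'k)^('k + 'k)" where
  "Vmat = (1 / sqrt 2) *\<^sub>R block_matrix (mat 1) (mat 1) (mat (- \<i>)) (mat \<i>)"


section \<open>State-space systems\<close>

definition cplx_matrix :: "real^'n^'m \<Rightarrow> complex^'n^'m" where
  "cplx_matrix X = map_matrix complex_of_real X"

definition transfer_matrix ::
  "real^'k^'k \<Rightarrow> real^'l^'k \<Rightarrow> real^'k^'p \<Rightarrow> real^'l^'p \<Rightarrow> complex \<Rightarrow> complex^'l^'p" where
  "transfer_matrix A B C D s =
     cplx_matrix D + cplx_matrix C ** matrix_inv (mat s - cplx_matrix A) ** cplx_matrix B"

text \<open>The transfer matrix is a rational function of \<open>s\<close>; \<open>transfer_matrix\<close> gives its value at every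
  \<open>s\<close> which is not an eigenvalue of \<open>A\<close>. (For other \<open>s\<close>, \<open>matrix_inv\<close> is unspecified.)\<close>

definition resolvent_set :: "real^'k^'k \<Rightarrow> complex set" where
  "resolvent_set A = {s. invertible (mat s - cplx_matrix A)}"

definition BAE_q_out_p_in ::
  "real^'k^'k \<Rightarrow> real^('m::finite + 'm)^'k \<Rightarrow> real^'k^('m + 'm) \<Rightarrow> real^('m + 'm)^('m + 'm) \<Rightarrow> bool" where
  "BAE_q_out_p_in A B C D \<longleftrightarrow>
     (\<forall>s \<in> resolvent_set A. \<forall>i j. transfer_matrix A B C D s $ Inl i $ Inr j = 0)"

definition BAE_p_out_q_in ::
  "real^'k^'k \<Rightarrow> real^('m::finite + 'm)^'k \<Rightarrow> real^'k^('m + 'm) \<Rightarrow> real^('m + 'm)^('m + 'm) \<Rightarrow> bool" where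
  "BAE_p_out_q_in A B C D \<longleftrightarrow>
     (\<forall>s \<in> resolvent_set A. \<forall>i j. transfer_matrix A B C D s $ Inr i $ Inl j = 0)"

primrec matrix_power :: "real^'k^'k \<Rightarrow> nat \<Rightarrow> real^'k^'k" where
  "matrix_power A 0 = mat 1"
| "matrix_power A (Suc l) = matrix_power A l ** A"

text \<open>The observability matrix stacks the blocks \<open>C A\<^sup>l\<close> for \<open>l < dim A\<close>; only its set of rows is
  needed, and its row space is the span of that set.\<close>

definition observability_rows :: "real^'k^'k \<Rightarrow> real^'k^'p \<Rightarrow> (real^'k) set" where
  "observability_rows A C = (\<Union>l<CARD('k). rows (C ** matrix_power A l))"

definition QND_matrix :: "real^'k^'k \<Rightarrow> real^'l^'k \<Rightarrow> real^'k^'p \<Rightarrow> real^'k^'r \<Rightarrow> bool" where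
  "QND_matrix A B C T \<longleftrightarrow>
     (\<exists>F. T ** A = F ** T) \<and> T ** B = 0 \<and> rows T \<subseteq> span (observability_rows A C)"


section \<open>Annihilation operators and linear quantum systems\<close>

text \<open>The operators live in an arbitrary nontrivial unital complex *-algebra that contains
  \<open>a\<^sub>1, \<dots>, a\<^sub>n\<close> satisfying the canonical commutation relations, e.g. the operators generated by
  the \<open>a\<^sub>j\<close> and their adjoints on the finite-particle vectors of Fock space.\<close>

definition commutator :: "'a::ring_1 \<Rightarrow> 'a \<Rightarrow> 'a" where
  "commutator x y = x * y - y * x"

locale ccr_star_algebra = vector_space cscale
  for cscale :: "complex \<Rightarrow> 'alg::ring_1 \<Rightarrow> 'alg" +
  fixes star :: "'alg \<Rightarrow> 'alg"
    and a :: "'alg^'n"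
  assumes scale_mult_left: "cscale c x * y = cscale c (x * y)"
    and scale_mult_right: "x * cscale c y = cscale c (x * y)"
    and star_star: "star (star x) = x"
    and star_add: "star (x + y) = star x + star y"
    and star_mult: "star (x * y) = star y * star x"
    and star_scale: "star (cscale c x) = cscale (cnj c) (star x)"
    and ccr_annihilation_creation: "commutator (a $ j) (star (a $ k)) = (if j = k then 1 else 0)"
    and ccr_annihilation: "commutator (a $ j) (a $ k) = 0"

definition op_apply :: "(complex \<Rightarrow> 'alg::ring_1 \<Rightarrow> 'alg) \<Rightarrow> complex^'n^'m \<Rightarrow> 'alg^'n \<Rightarrow> 'alg^'m" where
  "op_apply cscale M v = (\<chi> i. \<Sum>j\<in>UNIV. cscale (M $ i $ j) (v $ j))"

definition creation_vec :: "('alg \<Rightarrow> 'alg) \<Rightarrow> 'alg^'n \<Rightarrow> 'alg^'n" where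
  "creation_vec star a = (\<chi> j. star (a $ j))"

definition doubled_vec :: "('alg \<Rightarrow> 'alg) \<Rightarrow> 'alg^'n \<Rightarrow> 'alg^('n + 'n)" where
  "doubled_vec star a = (\<chi> i. case i of Inl j \<Rightarrow> a $ j | Inr j \<Rightarrow> creation_vec star a $ j)"

definition quadratures ::
  "(complex \<Rightarrow> 'alg::ring_1 \<Rightarrow> 'alg) \<Rightarrow> ('alg \<Rightarrow> 'alg) \<Rightarrow> 'alg^'n \<Rightarrow> 'alg^('n + 'n)" where
  "quadratures cscale star a = op_apply cscale Vmat (doubled_vec star a)"

definition coupling_operator ::
  "(complex \<Rightarrow> 'alg::ring_1 \<Rightarrow> 'alg) \<Rightarrow> ('alg \<Rightarrow> 'alg) \<Rightarrow> 'alg^'n \<Rightarrow>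
   complex^'n^'m \<Rightarrow> complex^'n^'m \<Rightarrow> 'alg^'m" where
  "coupling_operator cscale star a Cm Cp =
     op_apply cscale Cm a + op_apply cscale Cp (creation_vec star a)"

definition hamiltonian ::
  "(complex \<Rightarrow> 'alg::ring_1 \<Rightarrow> 'alg) \<Rightarrow> ('alg \<Rightarrow> 'alg) \<Rightarrow> 'alg^'n \<Rightarrow>
   complex^'n^'n \<Rightarrow> complex^'n^'n \<Rightarrow> 'alg" where
  "hamiltonian cscale star a Om Op = cscale (1/2)
     (\<Sum>i\<in>UNIV. star (doubled_vec star a $ i) *
        op_apply cscale (doubled Om Op) (doubled_vec star a) $ i)"

definition linear_quantum_system ::
  "complex^'m^'m \<Rightarrow> complex^'n^'m \<Rightarrow> complex^'n^'m \<Rightarrow> complex^'n^'n \<Rightarrow> complex^'n^'n \<Rightarrow> bool" where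
  "linear_quantum_system S Cm Cp Om Op \<longleftrightarrow> unitary S \<and> hermitian (doubled Om Op)"

text \<open>The complex matrices below have real entries (see the lemmas \<open>cplx_sysA\<close> etc.),
  so taking real parts only changes the type.\<close>

definition real_part :: "complex^'n^'m \<Rightarrow> real^'n^'m" where
  "real_part X = map_matrix Re X"

definition sysA_cplx ::
  "complex^'n^'m \<Rightarrow> complex^'n^'m \<Rightarrow> complex^'n^'n \<Rightarrow> complex^'n^'n \<Rightarrow> complex^('n + 'n)^('n + 'n)" where
  "sysA_cplx Cm Cp Om Op =
     Vmat ** (mat (- \<i>) ** Jmat ** doubled Om Op
              - (1/2) *\<^sub>R (flat (doubled Cm Cp) ** doubled Cm Cp)) ** dagger Vmat"

definition sysB_cplx ::
  "complex^'m^'m \<Rightarrow> complex^'n^'m \<Rightarrow> complex^'n^'m \<Rightarrow> complex^('m + 'm)^('n + 'n)" where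
  "sysB_cplx S Cm Cp = - (Vmat ** flat (doubled Cm Cp) ** doubled S 0 ** dagger Vmat)"

definition sysC_cplx ::
  "complex^'n^'m \<Rightarrow> complex^'n^'m \<Rightarrow> complex^('n + 'n)^('m + 'm)" where
  "sysC_cplx Cm Cp = Vmat ** doubled Cm Cp ** dagger Vmat"

definition sysD_cplx :: "complex^'m^'m \<Rightarrow> complex^('m + 'm)^('m + 'm)" where
  "sysD_cplx S = Vmat ** doubled S 0 ** dagger Vmat"

definition sysA ::
  "complex^'n^'m \<Rightarrow> complex^'n^'m \<Rightarrow> complex^'n^'n \<Rightarrow> complex^'n^'n \<Rightarrow> real^('n + 'n)^('n + 'n)" where
  "sysA Cm Cp Om Op = real_part (sysA_cplx Cm Cp Om Op)"

definition sysB ::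
  "complex^'m^'m \<Rightarrow> complex^'n^'m \<Rightarrow> complex^'n^'m \<Rightarrow> real^('m + 'm)^('n + 'n)" where
  "sysB S Cm Cp = real_part (sysB_cplx S Cm Cp)"

definition sysC ::
  "complex^'n^'m \<Rightarrow> complex^'n^'m \<Rightarrow> real^('n + 'n)^('m + 'm)" where
  "sysC Cm Cp = real_part (sysC_cplx Cm Cp)"

definition sysD :: "complex^'m^'m \<Rightarrow> real^('m + 'm)^('m + 'm)" where
  "sysD S = real_part (sysD_cplx S)"

definition QND_variable ::
  "(complex \<Rightarrow> 'alg::ring_1 \<Rightarrow> 'alg) \<Rightarrow> 'alg^'k \<Rightarrow>
   real^'k^'k \<Rightarrow> real^'l^'k \<Rightarrow> real^'k^'p \<Rightarrow> 'alg^'r \<Rightarrow> bool" where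
  "QND_variable cscale x A B C z \<longleftrightarrow>
     (\<exists>T :: real^'k^'r. z = op_apply cscale (cplx_matrix T) x \<and> QND_matrix A B C T)"


subsection \<open>The quadrature matrices are real\<close>

lemma sum_UNIV_sum:
  fixes f :: "'a::finite + 'b::finite \<Rightarrow> 'c::comm_monoid_add"
  shows "(\<Sum>x\<in>UNIV. f x) = (\<Sum>x\<in>UNIV. f (Inl x)) + (\<Sum>x\<in>UNIV. f (Inr x))"
  by (subst UNIV_Plus_UNIV[symmetric]) (simp add: sum.Plus del: UNIV_Plus_UNIV)

lemma block_matrix_mult:
  fixes A :: "'a::semiring_1^'n^'m"
  shows "block_matrix A B C D ** block_matrix A' B' C' D' =
     block_matrix (A ** A' + B ** C') (A ** B' + B ** D') (C ** A' + D ** C') (C ** B' + D ** D')"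
  by (simp add: vec_eq_iff block_matrix_def matrix_matrix_mult_def sum_UNIV_sum split: sum.split)

lemma conj_matrix_mult: "conj_matrix (A ** B) = conj_matrix A ** conj_matrix B"
  by (simp add: vec_eq_iff conj_matrix_def matrix_matrix_mult_def)

lemma conj_matrix_simps:
  "conj_matrix (A + B) = conj_matrix A + conj_matrix B"
  "conj_matrix (A - B) = conj_matrix A - conj_matrix B"
  "conj_matrix (- A) = - conj_matrix A"
  "conj_matrix (r *\<^sub>R A) = r *\<^sub>R conj_matrix A"
  "conj_matrix (conj_matrix A) = A"
  by (simp_all add: vec_eq_iff conj_matrix_def)

lemma conj_matrix_mat: "conj_matrix (mat z) = mat (cnj z)"
  by (simp add: vec_eq_iff conj_matrix_def mat_def)

definition is_doubled :: "complex^('n::finite + 'n)^('m::finite + 'm) \<Rightarrow> bool" where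
  "is_doubled X \<longleftrightarrow> (\<exists>U V. X = doubled U V)"

lemma is_doubled_doubled: "is_doubled (doubled U V)"
  by (auto simp: is_doubled_def)

lemma is_doubled_mult:
  assumes "is_doubled X" "is_doubled Y"
  shows "is_doubled (X ** Y)"
proof -
  obtain U V U' V' where "X = doubled U V" "Y = doubled U' V'"
    using assms by (auto simp: is_doubled_def)
  then have "X ** Y = doubled (U ** U' + V ** conj_matrix V') (U ** V' + V ** conj_matrix U')"
    by (simp add: doubled_def block_matrix_mult conj_matrix_simps conj_matrix_mult add.commute)
  then show ?thesis by (simp add: is_doubled_doubled)
qed

lemma is_doubled_diff: "is_doubled X \<Longrightarrow> is_doubled Y \<Longrightarrow> is_doubled (X - Y)"
proof -
  assume "is_doubled X" "is_doubled Y"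
  then obtain U V U' V' where "X = doubled U V" "Y = doubled U' V'"
    by (auto simp: is_doubled_def)
  then have "X - Y = doubled (U - U') (V - V')"
    by (simp add: doubled_def vec_eq_iff block_matrix_def conj_matrix_simps split: sum.split)
  then show ?thesis by (auto simp: is_doubled_def)
qed

lemma is_doubled_scaleR: "is_doubled X \<Longrightarrow> is_doubled (r *\<^sub>R X)"
proof -
  assume "is_doubled X"
  then obtain U V where "X = doubled U V" by (auto simp: is_doubled_def)
  then have "r *\<^sub>R X = doubled (r *\<^sub>R U) (r *\<^sub>R V)"
    by (simp add: doubled_def vec_eq_iff block_matrix_def conj_matrix_simps split: sum.split)
  then show ?thesis by (auto simp: is_doubled_def)
qed

lemma mat_mult_left: "mat c ** M = (\<chi> i j. c * M $ i $ j)"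
  for c :: complex
  by (simp add: vec_eq_iff matrix_matrix_mult_def mat_def if_distrib if_distribR cong: if_cong)

lemma mat_mult_right: "M ** mat c = (\<chi> i j. c * M $ i $ j)"
  for c :: complex
  by (simp add: vec_eq_iff matrix_matrix_mult_def mat_def if_distrib cong: if_cong)

lemma is_doubled_iJ: "is_doubled (mat (- \<i>) ** Jmat :: complex^('k::finite + 'k)^('k + 'k))"
proof -
  have "(mat (- \<i>) ** Jmat :: complex^('k + 'k)^('k + 'k)) = doubled (mat (- \<i>)) 0"
    unfolding mat_mult_left
    by (auto simp: doubled_def vec_eq_iff block_matrix_def conj_matrix_def Jmat_def mat_def
        split: sum.split)
  then show ?thesis by (simp add: is_doubled_doubled)
qed

lemma is_doubled_flat: "is_doubled (flat (doubled U V))"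
proof -
  have d: "dagger (doubled U V) =
      block_matrix (dagger U) (transpose V) (dagger V) (transpose U)"
    by (simp add: doubled_def vec_eq_iff block_matrix_def conj_matrix_def dagger_def transpose_def
        split: sum.split)
  have "flat (doubled U V) = doubled (dagger U) (- transpose V)"
    unfolding flat_def d Jmat_def block_matrix_mult mat_mult_left mat_mult_right
    by (simp add: dagger_def doubled_def vec_eq_iff block_matrix_def conj_matrix_def transpose_def
        matrix_matrix_mult_def split: sum.split)
  then show ?thesis by (simp add: is_doubled_doubled)
qed

lemma real_Vmat_conj:
  fixes X :: "complex^('n::finite + 'n)^('m::finite + 'm)"
  assumes "is_doubled X"
  shows "Vmat ** X ** dagger Vmat = cplx_matrix (real_part (Vmat ** X ** dagger Vmat))"
proof -
  obtain U V where X: "X = doubled U V" using assms by (auto simp: is_doubled_def)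
  have V: "(Vmat :: complex^('k::finite + 'k)^('k + 'k)) =
      block_matrix (mat (1 / sqrt 2)) (mat (1 / sqrt 2)) (mat (- \<i> / sqrt 2)) (mat (\<i> / sqrt 2))"
    by (auto simp: Vmat_def vec_eq_iff block_matrix_def mat_def complex_eq_iff split: sum.split)
  have dV: "dagger (Vmat :: complex^('k::finite + 'k)^('k + 'k)) =
      block_matrix (mat (1 / sqrt 2)) (mat (\<i> / sqrt 2)) (mat (1 / sqrt 2)) (mat (- \<i> / sqrt 2))"
    by (auto simp: V dagger_def conj_matrix_def transpose_def vec_eq_iff block_matrix_def mat_def
        split: sum.split)
  have "Im ((Vmat ** X ** dagger Vmat) $ i $ j) = 0" for i j
    unfolding X dV unfolding V doubled_def block_matrix_mult mat_mult_left mat_mult_right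
    by (cases i; cases j) (simp_all add: block_matrix_def conj_matrix_def algebra_simps)
  then show ?thesis
    by (simp add: vec_eq_iff cplx_matrix_def real_part_def complex_eq_iff)
qed

lemma cplx_sysA: "cplx_matrix (sysA Cm Cp Om Op) = sysA_cplx Cm Cp Om Op"
  unfolding sysA_def sysA_cplx_def
  by (intro real_Vmat_conj[symmetric] is_doubled_diff is_doubled_mult is_doubled_scaleR
      is_doubled_iJ is_doubled_flat is_doubled_doubled)

lemma cplx_sysB: "cplx_matrix (sysB S Cm Cp) = sysB_cplx S Cm Cp"
proof -
  let ?X = "Vmat ** (flat (doubled Cm Cp) ** doubled S 0) ** dagger Vmat"
  have X: "cplx_matrix (real_part ?X) = ?X"
    by (intro real_Vmat_conj[symmetric] is_doubled_mult is_doubled_flat is_doubled_doubled)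
  have minus: "cplx_matrix (real_part (- X)) = - cplx_matrix (real_part X)"
    for X :: "complex^'x^'y"
    by (simp add: vec_eq_iff cplx_matrix_def real_part_def)
  show ?thesis
    using X unfolding sysB_def sysB_cplx_def by (simp add: minus matrix_mul_assoc)
qed

lemma cplx_sysC: "cplx_matrix (sysC Cm Cp) = sysC_cplx Cm Cp"
  unfolding sysC_def sysC_cplx_def
  by (intro real_Vmat_conj[symmetric] is_doubled_doubled)

lemma cplx_sysD: "cplx_matrix (sysD S) = sysD_cplx S"
  unfolding sysD_def sysD_cplx_def
  by (intro real_Vmat_conj[symmetric] is_doubled_doubled)

end

theory Submission
  imports Defs
begin

text \<open>Write \<open>K\<close> for \<open>doubled Cm Cp\<close> and \<open>\<Omega>\<close> for \<open>doubled Om Op\<close>. The commutation relations say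
  \<open>[p b, b\<^sub>k\<^sup>*] = (p J)\<^sub>k\<close> for a linear form \<open>p b\<close> in the ladder operators \<open>b = (a, a\<^sup>#)\<close>; in particular
  the ladder operators are linearly independent. Hence the operator hypotheses become matrix
  identities: self-adjointness of \<open>L\<close> makes the two halves of \<open>K\<close> equal, commutativity gives
  \<open>K J K\<^sup>\<dagger> = 0\<close>, and \<open>[L, H] = 0\<close> gives \<open>K J \<Omega> = 0\<close>. The first identity kills the damping term
  of \<open>A\<close>, and the others give \<open>C A = 0\<close> and \<open>C B = 0\<close>. So \<open>C (s - A) = s C\<close>, the transfer matrix is
  \<open>D = 1\<close>, and \<open>L\<close>, whose coefficients are up to a scalar the upper half of \<open>C\<close>, is constant in
  time and observable.\<close>

section \<open>Commutators, exchange of halves, and block matrices\<close>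

lemma commutator_sum_left: "commutator (sum f I) y = (\<Sum>i\<in>I. commutator (f i) y)"
  by (simp add: commutator_def sum_distrib_left sum_distrib_right sum_subtractf)

lemma commutator_sum_right: "commutator y (sum f I) = (\<Sum>i\<in>I. commutator y (f i))"
  by (simp add: commutator_def sum_distrib_left sum_distrib_right sum_subtractf)

lemma commutator_mult_right: "commutator x (y * z) = commutator x y * z + y * commutator x z"
  by (simp add: commutator_def algebra_simps)

text \<open>Taking adjoints acts on the indices of the ladder vector by this involution.\<close>

definition swap_halves :: "'k + 'k \<Rightarrow> 'k + 'k" where
  "swap_halves = case_sum Inr Inl"

lemma swap_halves_simps [simp]:
  "swap_halves (Inl i) = Inr i" "swap_halves (Inr i) = Inl i"
  by (simp_all add: swap_halves_def)

lemma swap_halves_swap_halves [simp]: "swap_halves (swap_halves i) = i"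
  by (cases i) simp_all

lemma sum_swap_halves:
  fixes f :: "'k::finite + 'k \<Rightarrow> 'b::comm_monoid_add"
  shows "(\<Sum>i\<in>UNIV. f (swap_halves i)) = (\<Sum>i\<in>UNIV. f i)"
  by (simp add: sum_UNIV_sum add.commute)

text \<open>This is the doubled-up structure in index form; combined with Hermiticity it gives the
  symmetry of the Hamiltonian matrix.\<close>

lemma doubled_swap_halves:
  "doubled U V $ swap_halves i $ swap_halves j = cnj (doubled U V $ i $ j)"
  by (cases i; cases j) (simp_all add: doubled_def block_matrix_def conj_matrix_def)

lemma doubled_one: "doubled (mat 1) 0 = mat 1"
  by (auto simp: doubled_def block_matrix_def conj_matrix_def mat_def vec_eq_iff split: sum.split)

lemma dagger_entry: "dagger X $ i $ j = cnj (X $ j $ i)"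
  by (simp add: dagger_def conj_matrix_def transpose_def)

lemma hermitian_cnj: "hermitian X \<Longrightarrow> cnj (X $ i $ j) = X $ j $ i"
  by (metis hermitian_def dagger_entry)

lemma Jmat_entries:
  "Jmat $ Inl i $ Inl j = (if i = j then 1 else 0)"
  "Jmat $ Inl i $ Inr j = 0"
  "Jmat $ Inr i $ Inl j = 0"
  "Jmat $ Inr i $ Inr j = (if i = j then - 1 else 0)"
  by (simp_all add: Jmat_def block_matrix_def mat_def)

lemma Jmat_Jmat: "Jmat ** Jmat = mat 1"
  by (auto simp: Jmat_def block_matrix_mult vec_eq_iff mat_mult_left)
    (auto simp: block_matrix_def mat_def split: sum.split)

lemma vector_Jmat_eq_0: "p v* Jmat = 0 \<Longrightarrow> p = 0"
  by (metis Jmat_Jmat vector_matrix_mul_assoc vector_matrix_mul_rid vector_matrix_mult_0)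

lemma matrix_mult_row: "(A ** B) $ i = A $ i v* B"
  for A :: "'a::comm_semiring_1^'n^'m"
  by (simp add: vec_eq_iff matrix_matrix_mult_def vector_matrix_mult_def mult.commute)

lemma Vmat_blocks:
  "Vmat = block_matrix (mat (1 / sqrt 2)) (mat (1 / sqrt 2)) (mat (- \<i> / sqrt 2)) (mat (\<i> / sqrt 2))"
  by (auto simp: Vmat_def vec_eq_iff block_matrix_def mat_def complex_eq_iff split: sum.split)

lemma dagger_Vmat_blocks:
  "dagger Vmat =
     block_matrix (mat (1 / sqrt 2)) (mat (\<i> / sqrt 2)) (mat (1 / sqrt 2)) (mat (- \<i> / sqrt 2))"
  by (auto simp: Vmat_blocks dagger_def conj_matrix_def transpose_def vec_eq_iff block_matrix_def
      mat_def split: sum.split)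

lemma dagger_Vmat_Vmat: "dagger Vmat ** Vmat = mat 1"
proof -
  have "complex_of_real (sqrt 2) * complex_of_real (sqrt 2) = 2"
    by (simp flip: of_real_mult)
  then show ?thesis
    unfolding dagger_Vmat_blocks unfolding Vmat_blocks block_matrix_mult mat_mult_left
    by (auto simp: vec_eq_iff block_matrix_def mat_def field_simps split: sum.split)
qed

lemma Vmat_dagger_Vmat: "Vmat ** dagger Vmat = mat 1"
  using dagger_Vmat_Vmat matrix_left_right_inverse by blast

text \<open>Unitarity of \<open>Vmat\<close> cancels the inner factors, so products of quadrature
  matrices can be computed in ladder coordinates.\<close>

lemma Vmat_conj_mult:
  fixes X :: "complex^('k::finite + 'k)^('m::finite + 'm)"
    and Y :: "complex^('n::finite + 'n)^('k + 'k)"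
  shows "Vmat ** X ** dagger Vmat ** (Vmat ** Y ** dagger Vmat) = Vmat ** (X ** Y) ** dagger Vmat"
proof -
  have "dagger Vmat ** (Vmat ** Z) = Z" for Z :: "complex^('n + 'n)^('k + 'k)"
    by (simp add: matrix_mul_assoc dagger_Vmat_Vmat)
  then show ?thesis
    by (simp flip: matrix_mul_assoc)
qed

lemma matrix_mult_zero [simp]:
  fixes X :: "'a::semiring_1^'n^'m"
  shows "(0 :: 'a^'m^'k) ** X = 0" "X ** (0 :: 'a^'k^'n) = 0"
  by (simp_all add: vec_eq_iff matrix_matrix_mult_def)

lemma matrix_mult_minus_right:
  fixes X :: "'a::ring_1^'n^'m" and Y :: "'a^'k^'n"
  shows "X ** (- Y) = - (X ** Y)"
  by (simp add: vec_eq_iff matrix_matrix_mult_def sum_negf)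

lemma cplx_matrix_mult: "cplx_matrix (X ** Y) = cplx_matrix X ** cplx_matrix Y"
  by (simp add: vec_eq_iff cplx_matrix_def matrix_matrix_mult_def)

lemma cplx_matrix_eq_0_iff: "cplx_matrix X = 0 \<longleftrightarrow> X = 0"
  by (simp add: vec_eq_iff cplx_matrix_def)

section \<open>Linear and quadratic forms in the ladder operators\<close>

context ccr_star_algebra
begin

abbreviation ladder :: "'n + 'n \<Rightarrow> 'alg" where
  "ladder i \<equiv> doubled_vec star a $ i"

definition linear_form :: "complex^('n + 'n) \<Rightarrow> 'alg" where
  "linear_form p = (\<Sum>i\<in>UNIV. cscale (p $ i) (ladder i))"

lemma star_0: "star 0 = 0"
  using star_add[of 0 0] by simp

lemma star_minus: "star (- x) = - star x"
  using star_add[of "- x" x] by (simp add: star_0 eq_neg_iff_add_eq_0)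

lemma star_diff: "star (x - y) = star x - star y"
  using star_add[of x "- y"] by (simp add: star_minus)

lemma star_sum: "star (sum f I) = (\<Sum>i\<in>I. star (f i))"
  by (induction I rule: infinite_finite_induct) (simp_all add: star_0 star_add)

lemma star_commutator: "star (commutator x y) = commutator (star y) (star x)"
  by (simp add: commutator_def star_diff star_mult)

lemma commutator_scale_left: "commutator (cscale c x) y = cscale c (commutator x y)"
  by (simp add: commutator_def scale_mult_left scale_mult_right scale_right_diff_distrib)

lemma commutator_scale_right: "commutator x (cscale c y) = cscale c (commutator x y)"
  by (simp add: commutator_def scale_mult_left scale_mult_right scale_right_diff_distrib)

lemma star_ladder: "star (ladder i) = ladder (swap_halves i)"
  by (cases i) (simp_all add: doubled_vec_def creation_vec_def star_star)

text \<open>Pairing with an adjoint in the second slot collects all the commutation relations in the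
  diagonal matrix \<open>Jmat\<close>.\<close>

lemma commutator_ladder: "commutator (ladder i) (star (ladder k)) = cscale (Jmat $ i $ k) 1"
proof -
  have "commutator (star (a $ j)) (star (a $ l)) = 0" for j l
    using star_commutator[of "a $ l" "a $ j"] by (simp add: ccr_annihilation star_0)
  moreover have "commutator (star (a $ j)) (a $ l) = (if l = j then - 1 else 0)" for j l
    using ccr_annihilation_creation[of l j] by (auto simp: commutator_def algebra_simps split: if_splits)
  ultimately show ?thesis
    by (cases i; cases k)
      (auto simp: doubled_vec_def creation_vec_def star_star Jmat_entries
        ccr_annihilation_creation ccr_annihilation)
qed

lemma commutator_linear_form:
  "commutator (linear_form p) (star (ladder k)) = cscale ((p v* Jmat) $ k) 1"
  by (simp add: linear_form_def commutator_sum_left commutator_scale_left commutator_ladder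
      vector_matrix_mult_def scale_sum_left mult.commute)

lemma linear_form_eq_0:
  assumes "linear_form p = 0"
  shows "p = 0"
proof -
  have "cscale ((p v* Jmat) $ k) 1 = 0" for k
    using commutator_linear_form[of p k] by (simp add: assms commutator_def)
  \<comment> \<open>Since \<open>1\<close> is nonzero in the algebra, the scalars in front of it
    vanish.\<close>
  then have "p v* Jmat = 0"
    by (simp add: vec_eq_iff)
  then show ?thesis
    by (rule vector_Jmat_eq_0)
qed

lemma linear_form_diff: "linear_form (p - q) = linear_form p - linear_form q"
  by (simp add: linear_form_def scale_left_diff_distrib sum_subtractf)

lemma linear_form_inject: "linear_form p = linear_form q \<longleftrightarrow> p = q"
  using linear_form_eq_0[of "p - q"] by (auto simp: linear_form_diff)

lemma star_linear_form: "star (linear_form p) = linear_form (\<chi> i. cnj (p $ swap_halves i))"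
proof -
  have "star (linear_form p) = (\<Sum>i\<in>UNIV. cscale (cnj (p $ i)) (ladder (swap_halves i)))"
    by (simp add: linear_form_def star_sum star_scale star_ladder)
  then show ?thesis
    by (simp add: linear_form_def
        flip: sum_swap_halves[of "\<lambda>i. cscale (cnj (p $ i)) (ladder (swap_halves i))"])
qed

text \<open>The scalar is the sesquilinear form \<open>p J q\<^sup>\<dagger>\<close>. The star on
  the second argument will disappear for self-adjoint forms.\<close>

lemma commutator_linear_forms:
  "commutator (linear_form p) (star (linear_form q)) =
     cscale (\<Sum>k\<in>UNIV. (p v* Jmat) $ k * cnj (q $ k)) 1"
proof -
  have "star (linear_form q) = (\<Sum>k\<in>UNIV. cscale (cnj (q $ k)) (star (ladder k)))"
    by (simp add: linear_form_def star_sum star_scale)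
  then show ?thesis
    by (simp add: commutator_sum_right commutator_scale_right commutator_linear_form
        scale_sum_left mult.commute)
qed

lemma op_apply_doubled_vec: "op_apply cscale M (doubled_vec star a) $ i = linear_form (M $ i)"
  by (simp add: op_apply_def linear_form_def)

lemma coupling_operator_linear_form:
  "coupling_operator cscale star a Cm Cp $ j = linear_form (doubled Cm Cp $ Inl j)"
  by (simp add: coupling_operator_def op_apply_def linear_form_def sum_UNIV_sum doubled_def
      block_matrix_def doubled_vec_def)

lemma op_apply_op_apply: "op_apply cscale M (op_apply cscale N v) = op_apply cscale (M ** N) v"
proof -
  have "(\<Sum>j\<in>UNIV. cscale (M $ i $ j) (\<Sum>k\<in>UNIV. cscale (N $ j $ k) (v $ k))) =
     (\<Sum>k\<in>UNIV. \<Sum>j\<in>UNIV. cscale (M $ i $ j * N $ j $ k) (v $ k))" for i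
    by (subst sum.swap) (simp add: scale_sum_right)
  then show ?thesis
    by (simp add: op_apply_def vec_eq_iff matrix_matrix_mult_def scale_sum_left)
qed

text \<open>The Hamiltonian is a quadratic form in the ladder operators; the Hermitian and doubled-up
  structure of its matrix makes the two terms of the Leibniz rule equal.\<close>

lemma commutator_hamiltonian:
  assumes "hermitian (doubled Om Op)"
  shows "commutator (linear_form p) (hamiltonian cscale star a Om Op) =
    linear_form (p v* (Jmat ** doubled Om Op))"
proof -
  let ?W = "doubled Om Op" and ?g = "p v* Jmat"
  let ?Z = "linear_form (p v* (Jmat ** ?W))"
  have Z: "?Z = (\<Sum>i\<in>UNIV. \<Sum>k\<in>UNIV. cscale (?g $ i * ?W $ i $ k) (ladder k))"
    by (subst sum.swap)
      (simp add: linear_form_def vector_matrix_mul_assoc[symmetric]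
        vector_matrix_mult_def[of "p v* Jmat"] scale_sum_left mult.commute)
  have g: "commutator (linear_form p) (ladder k) = cscale (?g $ swap_halves k) 1" for k
    using commutator_linear_form[of p "swap_halves k"] by (simp add: star_ladder)
  \<comment> \<open>Swapping both indices conjugates a doubled-up matrix, and conjugation transposes
    a Hermitian one.\<close>
  have W: "?W $ swap_halves i $ swap_halves k = ?W $ k $ i" for i k
    using hermitian_cnj[OF assms] by (simp add: doubled_swap_halves)
  have 1: "(\<Sum>i\<in>UNIV. commutator (linear_form p) (star (ladder i)) * linear_form (?W $ i)) = ?Z"
    by (simp add: Z commutator_linear_form linear_form_def[of "?W $ _"] scale_mult_left
        scale_sum_right)
  have "(\<Sum>i\<in>UNIV. star (ladder i) * commutator (linear_form p) (linear_form (?W $ i))) =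
    (\<Sum>i\<in>UNIV. \<Sum>k\<in>UNIV. cscale (?W $ i $ k * ?g $ swap_halves k) (ladder (swap_halves i)))"
    by (simp add: linear_form_def[of "?W $ _"] commutator_sum_right commutator_scale_right g
        scale_mult_right sum_distrib_left star_ladder)
  \<comment> \<open>Reindexing first \<open>i\<close> and then \<open>k\<close> moves both swaps
    onto \<open>?W\<close>, where \<open>W\<close> removes them at the price of a
    transposition.\<close>
  also have "\<dots> = (\<Sum>i\<in>UNIV. \<Sum>k\<in>UNIV.
      cscale (?W $ swap_halves i $ k * ?g $ swap_halves k) (ladder i))"
    by (subst sum_swap_halves[symmetric]) simp
  also have "\<dots> = (\<Sum>i\<in>UNIV. \<Sum>k\<in>UNIV. cscale (?W $ k $ i * ?g $ k) (ladder i))"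
    by (rule sum.cong, rule refl, subst sum_swap_halves[symmetric]) (simp add: W)
  also have "\<dots> = ?Z"
    unfolding Z by (subst sum.swap) (simp add: mult.commute)
  finally have 2: "(\<Sum>i\<in>UNIV. star (ladder i) *
      commutator (linear_form p) (linear_form (?W $ i))) = ?Z" .
  have "commutator (linear_form p) (hamiltonian cscale star a Om Op) = cscale (1/2) (?Z + ?Z)"
    by (simp only: hamiltonian_def commutator_scale_right commutator_sum_right
        commutator_mult_right op_apply_doubled_vec sum.distrib 1 2)
  also have "\<dots> = ?Z"
    by (simp add: scale_right_distrib flip: scale_left_distrib)
  finally show ?thesis .
qed

text \<open>The adjoint conjugates the coefficients and exchanges their halves; linear independence
  then allows comparing coefficients.\<close>

lemma self_adjoint_coupling:
  assumes "\<forall>j. star (coupling_operator cscale star a Cm Cp $ j) =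
    coupling_operator cscale star a Cm Cp $ j"
  shows "Cp = conj_matrix Cm"
proof -
  have "cnj (doubled Cm Cp $ Inl j $ swap_halves i) = doubled Cm Cp $ Inl j $ i" for i j
    using assms by (simp add: coupling_operator_linear_form star_linear_form linear_form_inject
        vec_eq_iff)
  from this[of _ "Inr _"] show ?thesis
    by (simp add: doubled_def block_matrix_def conj_matrix_def vec_eq_iff)
qed

end

section \<open>Vanishing damping, constant transfer matrix, and a QND criterion\<close>

lemma doubled_conj_row: "doubled X (conj_matrix X) $ Inr j = doubled X (conj_matrix X) $ Inl j"
  by (auto simp: vec_eq_iff doubled_def block_matrix_def conj_matrix_simps split: sum.split)

lemma vec_eq_iff_halves: "x = y \<longleftrightarrow> (\<forall>i. x $ Inl i = y $ Inl i) \<and> (\<forall>i. x $ Inr i = y $ Inr i)"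
  by (auto simp: vec_eq_iff) (metis sumE)

text \<open>Both halves of the matrix have the same rows, so in \<open>K\<^sup>\<dagger> J K\<close>
  the two signs of \<open>J\<close> cancel.\<close>

lemma flat_doubled_conj: "flat (doubled X (conj_matrix X)) ** doubled X (conj_matrix X) = 0"
proof -
  let ?K = "doubled X (conj_matrix X)"
  have "(dagger ?K ** (Jmat ** ?K)) $ i $ k = 0" for i k
    by (simp add: matrix_matrix_mult_def sum_UNIV_sum Jmat_entries dagger_entry
        doubled_conj_row if_distrib[of "\<lambda>x. x * _"] sum_negf cong: if_cong)
  then have "dagger ?K ** (Jmat ** ?K) = 0"
    by (simp add: vec_eq_iff)
  then show ?thesis
    by (simp add: flat_def flip: matrix_mul_assoc)
qed

lemma matrix_mult_matrix_inv:
  assumes "invertible X"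
  shows "X ** matrix_inv X = mat 1"
  using someI_ex[OF assms[unfolded invertible_def]] by (simp add: matrix_inv_def)

lemma transfer_matrix_eq_D:
  assumes "C ** A = 0" "C ** B = 0" and s: "s \<in> resolvent_set A"
  shows "transfer_matrix A B C D s = cplx_matrix D"
proof -
  let ?R = "mat s - cplx_matrix A"
  have inv: "?R ** matrix_inv ?R = mat 1"
    using s by (simp add: resolvent_set_def matrix_mult_matrix_inv)
  have CA: "cplx_matrix C ** cplx_matrix A = 0"
    using assms(1) by (simp flip: cplx_matrix_mult add: cplx_matrix_eq_0_iff)
  have CB: "cplx_matrix C ** cplx_matrix B = 0"
    using assms(2) by (simp flip: cplx_matrix_mult add: cplx_matrix_eq_0_iff)
  have "cplx_matrix C ** ?R = cplx_matrix C ** mat s - cplx_matrix C ** cplx_matrix A"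
    by (simp add: vec_eq_iff matrix_matrix_mult_def right_diff_distrib sum_subtractf)
  then have "cplx_matrix C ** ?R = mat s ** cplx_matrix C"
    by (simp add: CA mat_mult_left mat_mult_right)
  then have C: "cplx_matrix C = mat s ** (cplx_matrix C ** matrix_inv ?R)"
    by (metis inv matrix_mul_assoc matrix_mul_rid)
  have "cplx_matrix C ** matrix_inv ?R ** cplx_matrix B = 0"
  \<comment> \<open>Multiplying \<open>C\<close> by \<open>B\<close> gives
    \<open>s C R\<^sup>-\<^sup>1 B = C B = 0\<close>, which settles nonzero \<open>s\<close>. At
    \<open>s = 0\<close> the matrix \<open>A\<close> is invertible, so \<open>C A = 0\<close> forces
    \<open>C = 0\<close>.\<close>
  proof (cases "s = 0")
    case True
    then have "cplx_matrix C = 0"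
      using C by (simp add: mat_mult_left vec_eq_iff)
    then show ?thesis by simp
  next
    case False
    have "mat s ** (cplx_matrix C ** matrix_inv ?R ** cplx_matrix B) = 0"
      by (metis C CB matrix_mul_assoc)
    then show ?thesis
      using False by (simp add: mat_mult_left vec_eq_iff)
  qed
  then show ?thesis
    by (simp add: transfer_matrix_def)
qed

text \<open>Such a \<open>T\<close> inherits annihilation of \<open>A\<close> and \<open>B\<close>
  from \<open>C\<close>. The row-wise hypothesis covers the whole vector \<open>L\<close> as well as
  a single component.\<close>

lemma QND_matrix_of_rows:
  fixes A :: "real^'k^'k"
  assumes "C ** A = 0" "C ** B = 0" and rows: "\<And>j. \<exists>c i. T $ j = c *\<^sub>R C $ i"
  shows "QND_matrix A B C T"
proof -
  have zero: "T ** X = 0" if "C ** X = 0" for X :: "real^'x^'k"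
  proof -
    have "T $ j v* X = 0" for j
    proof -
      obtain c i where "T $ j = c *\<^sub>R C $ i"
        using rows by blast
      moreover have "C $ i v* X = 0"
        using that by (simp flip: matrix_mult_row)
      ultimately show ?thesis
        by (simp add: scaleR_vector_matrix_assoc)
    qed
    then show ?thesis
      by (subst vec_eq_iff) (simp add: matrix_mult_row)
  qed
  \<comment> \<open>The block \<open>l = 0\<close> of the observability matrix is \<open>C\<close>
    itself.\<close>
  have "rows C \<subseteq> observability_rows A C"
    using UN_upper[of 0 "{..<CARD('k)}" "\<lambda>l. rows (C ** matrix_power A l)"]
    by (simp add: observability_rows_def)
  moreover have "C $ i \<in> rows C" for i
    by (auto simp: rows_def row_def vec_lambda_eta)
  ultimately have "C $ i \<in> span (observability_rows A C)" for i
    by (blast intro: span_base)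
  then have "T $ j \<in> span (observability_rows A C)" for j
    using rows[of j] by (auto simp: span_scale)
  then have "rows T \<subseteq> span (observability_rows A C)"
    by (auto simp: rows_def row_def vec_lambda_eta)
  \<comment> \<open>The variables are constants of motion, so the autonomous dynamics is
    \<open>F = 0\<close>.\<close>
  moreover have "T ** A = 0 ** T"
    using zero[OF assms(1)] by simp
  ultimately show ?thesis
    unfolding QND_matrix_def using zero[OF assms(2)] by blast
qed

theorem mainTheorem4:
  fixes cscale :: "complex \<Rightarrow> 'alg::ring_1 \<Rightarrow> 'alg"
    and star :: "'alg \<Rightarrow> 'alg"
    and a :: "'alg^'n"
    and S :: "complex^'m^'m"
    and Cm Cp :: "complex^'n^'m"
    and Om Op :: "complex^'n^'n"
    and L :: "'alg^'m" and H :: 'alg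
    and A :: "real^('n + 'n)^('n + 'n)" and B :: "real^('m + 'm)^('n + 'n)"
    and C :: "real^('n + 'n)^('m + 'm)" and D :: "real^('m + 'm)^('m + 'm)"
    and x :: "'alg^('n + 'n)"
  assumes "ccr_star_algebra cscale star a"
    and "linear_quantum_system S Cm Cp Om Op"
    and "S = mat 1"
    and "L = coupling_operator cscale star a Cm Cp"
    and "H = hamiltonian cscale star a Om Op"
    and "x = quadratures cscale star a"
    and "A = sysA Cm Cp Om Op" and "B = sysB S Cm Cp" and "C = sysC Cm Cp" and "D = sysD S"
    and "\<forall>j. star (L $ j) = L $ j"
    and "\<forall>j k. commutator (L $ j) (L $ k) = 0"
    and "\<forall>j. commutator (L $ j) H = 0"
  shows "QND_variable cscale x A B C L
    \<and> (\<forall>j. QND_variable cscale x A B C (\<chi> _::1. L $ j))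
    \<and> (\<forall>s \<in> resolvent_set A. transfer_matrix A B C D s = mat 1)
    \<and> BAE_q_out_p_in A B C D
    \<and> BAE_p_out_q_in A B C D"
proof -
  interpret ccr_star_algebra cscale star a by fact
  note L = assms(4) and self_adjoint = assms(11) and commuting = assms(12)
    and conserved = assms(13)
  define K where "K = doubled Cm Cp"
  have herm: "hermitian (doubled Om Op)"
    using assms(2) by (simp add: linear_quantum_system_def)
  have Cp: "Cp = conj_matrix Cm"
    using self_adjoint by (intro self_adjoint_coupling) (simp add: L)
  have row: "K $ Inr j = K $ Inl j" for j
    by (simp add: K_def Cp doubled_conj_row)
  have L_form: "L $ j = linear_form (K $ Inl j)" for j
    by (simp add: L K_def coupling_operator_linear_form)

  have "K $ Inl j v* (Jmat ** doubled Om Op) = 0" for j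
  proof (rule linear_form_eq_0)
    show "linear_form (K $ Inl j v* (Jmat ** doubled Om Op)) = 0"
      using conserved commutator_hamiltonian[OF herm, of "K $ Inl j"]
      by (simp add: assms(5) L_form)
  qed
  \<comment> \<open>The lower rows of \<open>K\<close> repeat the upper ones, so the upper half
    suffices.\<close>
  then have KJW: "K ** (Jmat ** doubled Om Op) = 0"
    by (simp add: vec_eq_iff_halves matrix_mult_row row)

  \<comment> \<open>Self-adjointness of \<open>L $ k\<close> replaces its star by
    \<open>L $ k\<close>, so commutativity applies.\<close>
  have "(\<Sum>l\<in>UNIV. (K $ Inl j v* Jmat) $ l * cnj (K $ Inl k $ l)) = 0" for j k
    using commutator_linear_forms[of "K $ Inl j" "K $ Inl k"] self_adjoint commuting
    by (simp add: L_form)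
  then have "K ** Jmat ** dagger K = 0"
    by (simp add: vec_eq_iff_halves row matrix_mult_row vector_matrix_mult_def[of _ "dagger K"]
        dagger_entry mult.commute)
  then have K_flat: "K ** flat K = 0"
    by (simp add: flat_def matrix_mul_assoc)

  have C: "cplx_matrix C = Vmat ** K ** dagger Vmat"
    by (simp add: assms(9) cplx_sysC sysC_cplx_def K_def)
  \<comment> \<open>The damping term vanishes by \<open>flat_doubled_conj\<close>; only the
    Hamiltonian part remains.\<close>
  have A: "cplx_matrix A = Vmat ** (mat (- \<i>) ** Jmat ** doubled Om Op) ** dagger Vmat"
    by (simp add: assms(7) cplx_sysA sysA_cplx_def Cp flat_doubled_conj)
  have B: "cplx_matrix B = - (Vmat ** flat K ** dagger Vmat)"
    by (simp add: assms(3,8) cplx_sysB sysB_cplx_def K_def doubled_one)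
  have "K ** (mat (- \<i>) ** Jmat ** doubled Om Op) = mat (- \<i>) ** (K ** (Jmat ** doubled Om Op))"
    by (metis (no_types) mat_mult_left mat_mult_right matrix_mul_assoc)
  then have "cplx_matrix (C ** A) = 0"
    by (simp add: cplx_matrix_mult C A Vmat_conj_mult KJW)
  then have CA: "C ** A = 0"
    by (simp add: cplx_matrix_eq_0_iff)
  have "cplx_matrix (C ** B) = 0"
    by (simp add: cplx_matrix_mult C B Vmat_conj_mult matrix_mult_minus_right K_flat)
  then have CB: "C ** B = 0"
    by (simp add: cplx_matrix_eq_0_iff)
  have D: "cplx_matrix D = mat 1"
    by (simp add: assms(3,10) cplx_sysD sysD_cplx_def doubled_one Vmat_dagger_Vmat)

  \<comment> \<open>As the halves of \<open>K\<close> agree, the upper half of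
    \<open>C V = V K\<close> is \<open>2 / sqrt 2\<close> times that of \<open>K\<close>; the factor
    \<open>1 / sqrt 2\<close> normalises this to the coefficients of \<open>L\<close>.\<close>
  define T where "T = (\<chi> j. (1 / sqrt 2) *\<^sub>R C $ Inl j)"
  have T_row: "T $ j = (1 / sqrt 2) *\<^sub>R C $ Inl j" for j
    by (simp add: T_def)
  have CV: "cplx_matrix C ** Vmat = Vmat ** K"
    by (simp add: C dagger_Vmat_Vmat flip: matrix_mul_assoc)
  have sqrt2: "complex_of_real (sqrt 2) * complex_of_real (sqrt 2) = 2"
    by (simp flip: of_real_mult)
  have "(cplx_matrix T ** Vmat) $ j = K $ Inl j" for j
  proof -
    have "(cplx_matrix T ** Vmat) $ j $ i = (cplx_matrix C ** Vmat) $ Inl j $ i / sqrt 2" for i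
      by (simp add: T_def cplx_matrix_def matrix_matrix_mult_def sum_divide_distrib)
    moreover have "(Vmat ** K) $ Inl j $ i = 2 / sqrt 2 * K $ Inl j $ i" for i
      by (simp add: Vmat_blocks matrix_matrix_mult_def sum_UNIV_sum block_matrix_def mat_def
          row if_distrib[of "\<lambda>x. x * _"] cong: if_cong)
    ultimately show ?thesis
      using sqrt2 by (simp add: CV vec_eq_iff)
  qed
  then have L_T: "L = op_apply cscale (cplx_matrix T) x"
    by (simp add: assms(6) quadratures_def op_apply_op_apply op_apply_doubled_vec L_form
        vec_eq_iff[of L])

  have "QND_variable cscale x A B C L"
    unfolding QND_variable_def
    by (rule exI[of _ T], intro conjI L_T QND_matrix_of_rows CA CB) (blast intro: T_row)
  moreover have "QND_variable cscale x A B C (\<chi> _::1. L $ j)" for j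
    unfolding QND_variable_def
    by (rule exI[of _ "\<chi> _. T $ j"], intro conjI QND_matrix_of_rows CA CB)
      (auto simp: L_T op_apply_def cplx_matrix_def vec_eq_iff[where 'b = 1] intro: T_row)
  moreover have G: "transfer_matrix A B C D s = mat 1" if "s \<in> resolvent_set A" for s
    using transfer_matrix_eq_D[OF CA CB that] by (simp add: D)
  moreover have "BAE_q_out_p_in A B C D" "BAE_p_out_q_in A B C D"
    by (simp_all add: BAE_q_out_p_in_def BAE_p_out_q_in_def G mat_def)
  ultimately show ?thesis
    by blast
qed

end
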